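(* Let $W$ be a wallpaper group containing reflexions, and let $\bar W$ denote $W$ with its modified action on meromorphic functions. Let $f:\mathbb{C}\to\mathbb{CP}^1$ be meromorphic. Then $f$ is an elliptic function invariant under $\bar W$ if and only if 1. $f$ is invariant under the sensible subgroup of $W$, i.e. $f(g.z)=f(z)$ for every sense-preserving $g\in W$ and every $z\in\mathbb{C}$; and 2. for every reflexion $m\in W$, $f$ is real (i.e. takes values in $\mathbb{R}\cup\{\infty\}$) on the line fixed pointwise by $m$.
   Context: A wallpaper group is a group of rigid motions of the plane containing two non-parallel translations; it acts on $\mathbb{C}$ by $g.z=az+b$ if $g$ is sense-preserving and $g.z=a\bar z+b$ if $g$ is sense-reversing, where $|a|=1$. The sensible subgroup of $W$ is the subgroup of its sense-preserving elements. Modified action: a sense-preserving $g\in W$ sends $f$ to the function $z\mapsto f(g.z)$, and a sense-reversing $m\in W$ (reflexion or glide reflexion) sends $f$ to $\bar m.f(z)=\overline{f(m.z)}$ (with $\overline{\infty}=\infty$). $f$ is invariant under $\bar W$ if it is unchanged by the modified action of every element of $W$. An elliptic function is a meromorphic function on $\mathbb{C}$ with two nonzero periods $\omega_1,\omega_2$ satisfying $\omega_1/\omega_2\notin\mathbb{R}$. *)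

theory Defs
  imports "HOL-Complex_Analysis.Complex_Analysis" "HOL-Algebra.Bij"
begin

text \<open>The plane is identified with \<open>\<complex>\<close>; a motion is the self-map of \<open>\<complex>\<close> it induces.\<close>

definition sense_preserving :: "(complex \<Rightarrow> complex) \<Rightarrow> bool" where
  "sense_preserving g \<longleftrightarrow> (\<exists>a b. norm a = 1 \<and> g = (\<lambda>z. a * z + b))"

definition sense_reversing :: "(complex \<Rightarrow> complex) \<Rightarrow> bool" where
  "sense_reversing g \<longleftrightarrow> (\<exists>a b. norm a = 1 \<and> g = (\<lambda>z. a * cnj z + b))"

definition rigid_motion :: "(complex \<Rightarrow> complex) \<Rightarrow> bool" where
  "rigid_motion g \<longleftrightarrow> sense_preserving g \<or> sense_reversing g"

text \<open>
  \<open>BijGroup UNIV\<close> is the group of all bijections of \<open>\<complex>\<close> under composition.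
  Discreteness is not part of the definition.
\<close>

definition wallpaper_group :: "(complex \<Rightarrow> complex) set \<Rightarrow> bool" where
  "wallpaper_group W \<longleftrightarrow>
     subgroup W (BijGroup UNIV) \<and>
     (\<forall>g\<in>W. rigid_motion g) \<and>
     (\<exists>s t. s \<noteq> 0 \<and> t \<noteq> 0 \<and> s / t \<notin> \<real> \<and> (\<lambda>z. z + s) \<in> W \<and> (\<lambda>z. z + t) \<in> W)"

definition sensible_subgroup :: "(complex \<Rightarrow> complex) set \<Rightarrow> (complex \<Rightarrow> complex) set" where
  "sensible_subgroup W = {g \<in> W. sense_preserving g}"

definition fixed_points :: "(complex \<Rightarrow> complex) \<Rightarrow> complex set" where
  "fixed_points m = {z. m z = z}"

text \<open>
  A reflexion is a sense-reversing motion whose fixed points form a line; the other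
  sense-reversing motions are the glide reflexions, which have no fixed point.
\<close>

definition reflexion :: "(complex \<Rightarrow> complex) \<Rightarrow> bool" where
  "reflexion m \<longleftrightarrow> sense_reversing m \<and>
     (\<exists>p u. u \<noteq> 0 \<and> fixed_points m = range (\<lambda>t::real. p + of_real t * u))"

text \<open>\<open>\<complex>\<P>\<^sup>1 = \<complex> \<union> {\<infinity>}\<close>, with \<open>None\<close> for \<open>\<infinity>\<close>.\<close>

type_synonym riemann_sphere = "complex option"

definition sphere_cnj :: "riemann_sphere \<Rightarrow> riemann_sphere" where
  "sphere_cnj = map_option cnj"

definition sphere_real :: "riemann_sphere set" where
  "sphere_real = insert None (Some ` \<real>)"

text \<open>
  The library's convention for \<open>nicely_meromorphic_on\<close> is that a complex-valued function takes
  the value \<open>0\<close> at its poles and is continuous elsewhere. The constant \<open>\<infinity>\<close> is not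
  meromorphic.
\<close>

definition finite_part :: "(complex \<Rightarrow> riemann_sphere) \<Rightarrow> complex \<Rightarrow> complex" where
  "finite_part f z = (case f z of None \<Rightarrow> 0 | Some w \<Rightarrow> w)"

definition meromorphic_function :: "(complex \<Rightarrow> riemann_sphere) \<Rightarrow> bool" where
  "meromorphic_function f \<longleftrightarrow>
     finite_part f nicely_meromorphic_on UNIV \<and>
     (\<forall>z. f z = None \<longleftrightarrow> is_pole (finite_part f) z)"

definition elliptic_function :: "(complex \<Rightarrow> riemann_sphere) \<Rightarrow> bool" where
  "elliptic_function f \<longleftrightarrow> meromorphic_function f \<and>
     (\<exists>\<omega>1 \<omega>2. \<omega>1 \<noteq> 0 \<and> \<omega>2 \<noteq> 0 \<and> \<omega>1 / \<omega>2 \<notin> \<real> \<and>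
        (\<forall>z. f (z + \<omega>1) = f z) \<and> (\<forall>z. f (z + \<omega>2) = f z))"

text \<open>No motion is both sense-preserving and sense-reversing.\<close>

definition modified_action ::
  "(complex \<Rightarrow> complex) \<Rightarrow> (complex \<Rightarrow> riemann_sphere) \<Rightarrow> complex \<Rightarrow> riemann_sphere" where
  "modified_action g f =
     (if sense_preserving g then (\<lambda>z. f (g z)) else (\<lambda>z. sphere_cnj (f (g z))))"

definition invariant_modified ::
  "(complex \<Rightarrow> complex) set \<Rightarrow> (complex \<Rightarrow> riemann_sphere) \<Rightarrow> bool" where
  "invariant_modified W f \<longleftrightarrow> (\<forall>g\<in>W. modified_action g f = f)"

end

theory Submission
  imports Defs
begin

text \<open>
  Let \<open>m\<close> be a reflexion whose mirror carries real values of \<open>f\<close>. The function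
  \<open>z \<mapsto> cnj (f (m z))\<close> is again meromorphic and agrees with \<open>f\<close> on the mirror, hence everywhere by
  the identity theorem; this is invariance under \<open>m\<close>. Every other sense-reversing element of \<open>W\<close>
  is \<open>m\<close> composed with a sense-preserving one.
\<close>

section \<open>Sense-reversing motions\<close>

text \<open>Comparing the two affine expressions at 0, 1 and \<open>i\<close> forces the linear
  coefficient to vanish, although it has norm 1. This is what puts a reflexion in the conjugating
  branch of \<open>modified_action\<close>.\<close>

lemma not_sense_preserving_and_reversing:
  assumes "sense_reversing g"
  shows "\<not> sense_preserving g"
proof
  assume "sense_preserving g"
  then obtain a b where ab: "norm a = 1" "\<And>z. g z = a * z + b"
    unfolding sense_preserving_def by auto
  obtain c d where cd: "\<And>z. g z = c * cnj z + d"
    using assms unfolding sense_reversing_def by auto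
  have eq: "a * z + b = c * cnj z + d" for z
    using ab(2)[of z] cd[of z] by simp
  have "b = d"
    using eq[of 0] by simp
  moreover from this have "a = c"
    using eq[of 1] by simp
  ultimately have "a = 0"
    using eq[of \<i>] by (simp add: complex_eq_iff)
  with ab(1) show False
    by simp
qed

text \<open>Since \<open>norm a = 1\<close>, the square of \<open>a * cnj z + b\<close> is the
  translation by \<open>a * cnj b + b\<close>; a translation with a fixed point is the
  identity.\<close>

lemma sense_reversing_fixed_point_involution:
  assumes "sense_reversing m" "m p = p"
  shows "m (m z) = z"
proof -
  obtain a b where ab: "norm a = 1" "\<And>z. m z = a * cnj z + b"
    using assms(1) unfolding sense_reversing_def by auto
  have unit: "a * cnj a = 1"
    using ab(1) by (simp add: complex_norm_square[symmetric])
  have twice: "m (m w) = w + (a * cnj b + b)" for w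
  proof -
    have "m (m w) = (a * cnj a) * w + (a * cnj b + b)"
      by (simp add: ab(2) algebra_simps)
    with unit show ?thesis by simp
  qed
  have "a * cnj b + b = 0"
    using twice[of p] assms(2) by simp
  with twice show ?thesis by simp
qed

lemma sense_reversing_tendsto:
  assumes "sense_reversing m"
  shows "m \<midarrow>z\<rightarrow> m z"
proof -
  obtain a b where "m = (\<lambda>z. a * cnj z + b)"
    using assms unfolding sense_reversing_def by blast
  thus ?thesis
    by (auto intro!: tendsto_intros)
qed

lemma sense_reversing_comp:
  assumes "sense_reversing g" "sense_reversing h"
  shows "sense_preserving (g \<circ> h)"
proof -
  obtain a b c d where ab: "norm a = 1" "g = (\<lambda>z. a * cnj z + b)"
    and cd: "norm c = 1" "h = (\<lambda>z. c * cnj z + d)"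
    using assms unfolding sense_reversing_def by blast
  have "g \<circ> h = (\<lambda>z. (a * cnj c) * z + (a * cnj d + b))"
    by (simp add: ab cd fun_eq_iff algebra_simps)
  moreover have "norm (a * cnj c) = 1"
    by (simp add: ab cd norm_mult)
  ultimately show ?thesis
    unfolding sense_preserving_def by blast
qed

lemma sense_preserving_translation: "sense_preserving (\<lambda>z. z + s)"
  unfolding sense_preserving_def by (intro exI[of _ 1] exI[of _ s]) simp

lemma wallpaper_group_comp:
  assumes "wallpaper_group W" "g \<in> W" "h \<in> W"
  shows "g \<circ> h \<in> W"
proof -
  have sub: "subgroup W (BijGroup UNIV)"
    using assms(1) by (simp add: wallpaper_group_def)
  \<comment> \<open>The product of \<open>BijGroup\<close> is defined by restriction to the carrier,
    so it unfolds to composition only for arguments known to lie there.\<close>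
  have "g \<in> Bij UNIV" "h \<in> Bij UNIV"
    using subgroup.subset[OF sub] assms by (auto simp: BijGroup_def)
  hence "g \<otimes>\<^bsub>BijGroup UNIV\<^esub> h = g \<circ> h"
    by (simp add: BijGroup_def compose_def fun_eq_iff)
  with subgroup.m_closed[OF sub assms(2,3)] show ?thesis by simp
qed

section \<open>Meromorphic functions and complex conjugation\<close>

text \<open>A continuous involution is its own continuous inverse, and its injectivity keeps
  punctured neighbourhoods punctured. Limits and poles can thus be carried along conjugation and
  along reflexions.\<close>

lemma filtermap_at_involution:
  assumes "\<And>z. g \<midarrow>z\<rightarrow> g z" "\<And>z. g (g z) = z"
  shows "filtermap g (at z) = at (g z)"
proof (rule filtermap_fun_inverse)
  have lim: "filterlim g (at (g w)) (at w)" for w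
  proof -
    have "\<forall>\<^sub>F x in at w. g x \<noteq> g w"
      unfolding eventually_at_filter by (rule always_eventually) (metis assms(2))
    with assms(1)[of w] show ?thesis
      by (simp add: filterlim_at)
  qed
  show "filterlim g (at (g z)) (at z)"
    by (rule lim)
  show "filterlim g (at z) (at (g z))"
    using lim[of "g z"] by (simp only: assms(2))
qed (simp add: assms(2))

lemma filtermap_at_cnj: "filtermap cnj (at z) = at (cnj z)"
  by (rule filtermap_at_involution) (auto intro: tendsto_intros)

lemma is_pole_cnj_iff: "is_pole (\<lambda>z. cnj (f z)) z \<longleftrightarrow> is_pole f z"
  unfolding is_pole_def filterlim_at_infinity_conv_norm_at_top by simp

text \<open>Conjugating both argument and value preserves holomorphy, and conjugation maps punctured
  discs to punctured discs. Poles and finite limits at \<open>cnj z\<close> become poles and finite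
  limits at \<open>z\<close>.\<close>

lemma meromorphic_on_cnj_cnj:
  assumes "f meromorphic_on UNIV"
  shows "(\<lambda>z. cnj (f (cnj z))) meromorphic_on UNIV"
  unfolding meromorphic_on_altdef
proof (intro ballI conjI)
  fix z :: complex
  have iso: "isolated_singularity_at f (cnj z)" and ess: "not_essential f (cnj z)"
    using assms unfolding meromorphic_on_altdef by auto
  from iso obtain r where r: "r > 0" "f analytic_on ball (cnj z) r - {cnj z}"
    unfolding isolated_singularity_at_def by blast
  have "cnj ` (ball z r - {z}) = ball (cnj z) r - {cnj z}"
  proof -
    have "dist (cnj z) (cnj w) = dist z w" for w
      by (metis complex_cnj_diff complex_mod_cnj dist_norm)
    moreover from this have "dist (cnj z) w = dist z (cnj w)" for w
      by (metis complex_cnj_cnj)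
    ultimately show ?thesis
      unfolding image_cnj_conv_vimage_cnj by (simp add: set_eq_iff) (metis complex_cnj_cnj)
  qed
  hence "f holomorphic_on cnj ` (ball z r - {z})"
    using r(2) by (simp add: analytic_imp_holomorphic)
  hence "cnj \<circ> f \<circ> cnj holomorphic_on ball z r - {z}"
    by (intro holomorphic_on_compose_cnj_cnj) auto
  hence "(\<lambda>z. cnj (f (cnj z))) analytic_on ball z r - {z}"
    by (subst analytic_on_open) (auto simp: o_def)
  with r(1) show "isolated_singularity_at (\<lambda>z. cnj (f (cnj z))) z"
    unfolding isolated_singularity_at_def by blast
  show "not_essential (\<lambda>z. cnj (f (cnj z))) z"
  proof (cases "is_pole f (cnj z)")
    case True
    hence "is_pole (f \<circ> cnj) z"
      by (simp add: is_pole_compose_iff[OF filtermap_at_cnj])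
    thus ?thesis
      by (simp add: not_essential_def is_pole_cnj_iff o_def)
  next
    case False
    with ess obtain x where "f \<midarrow>cnj z\<rightarrow> x"
      unfolding not_essential_def by blast
    hence "((\<lambda>z. f (cnj z)) \<longlongrightarrow> x) (at z)"
      by (simp add: filtermap_at_cnj[symmetric] filterlim_filtermap)
    hence "((\<lambda>z. cnj (f (cnj z))) \<longlongrightarrow> cnj x) (at z)"
      by (rule tendsto_cnj)
    thus ?thesis
      unfolding not_essential_def by blast
  qed
qed

text \<open>The function is the doubly conjugated \<open>f\<close> precomposed with the affine map
  \<open>cnj a * z + cnj b\<close>, which is analytic.\<close>

lemma meromorphic_on_cnj_sense_reversing:
  assumes "f meromorphic_on UNIV" "sense_reversing m"
  shows "(\<lambda>z. cnj (f (m z))) meromorphic_on UNIV"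
proof -
  obtain a b where m: "m = (\<lambda>z. a * cnj z + b)"
    using assms(2) unfolding sense_reversing_def by blast
  have "(\<lambda>z. cnj (f (cnj (cnj a * z + cnj b)))) meromorphic_on UNIV"
    by (rule meromorphic_on_compose[OF meromorphic_on_cnj_cnj[OF assms(1)]])
      (auto intro!: analytic_intros)
  thus ?thesis
    by (simp add: m)
qed

text \<open>The difference is zero, or nonzero, off a sparse set; frequent zeros near
  \<open>p\<close> exclude the second case. The conclusion concerns punctured neighbourhoods because
  \<open>meromorphic_on\<close> does not control values at isolated points.\<close>

lemma meromorphic_identity:
  assumes "f meromorphic_on A" "g meromorphic_on A" "open A" "connected A"
    and "p \<in> A" "\<exists>\<^sub>F z in at p. f z = g z" "z \<in> A"
  shows "\<forall>\<^sub>F w in at z. f w = g w"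
proof -
  have "(\<lambda>w. f w - g w) meromorphic_on A"
    using assms by (intro meromorphic_intros)
  from meromorphic_imp_constant_or_avoid[OF this assms(3,4), of 0]
  consider "\<forall>\<^sub>\<approx>w\<in>A. f w = g w" | "\<forall>\<^sub>\<approx>w\<in>A. f w \<noteq> g w"
    by auto
  thus ?thesis
  proof cases
    case 1
    with assms show ?thesis by (simp add: eventually_cosparse_open_eq)
  next
    case 2
    with assms show ?thesis by (simp add: eventually_cosparse_open_eq frequently_def)
  qed
qed

text \<open>Every point of a line is an accumulation point of it, so agreement on a mirror is enough
  to start the identity theorem.\<close>

lemma frequently_at_line:
  fixes p u :: complex
  assumes "u \<noteq> 0" "\<And>t::real. P (p + of_real t * u)"
  shows "\<exists>\<^sub>F z in at p. P z"
proof -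
  have "((\<lambda>t::real. p + of_real t * u) \<longlongrightarrow> p + of_real 0 * u) (at 0)"
    by (intro tendsto_intros)
  hence "filterlim (\<lambda>t::real. p + of_real t * u) (at p) (at 0)"
    using assms(1) by (auto simp: filterlim_at eventually_at_filter)
  moreover have "\<exists>\<^sub>F t in at (0::real). P (p + of_real t * u)"
    using assms(2) by (intro eventually_frequently) auto
  ultimately show ?thesis
    unfolding frequently_def filterlim_iff by blast
qed

section \<open>Invariance under reflexions\<close>

lemma sphere_cnj_fixed_iff: "sphere_cnj x = x \<longleftrightarrow> x \<in> sphere_real"
  by (cases x) (auto simp: sphere_cnj_def sphere_real_def Reals_cnj_iff)

lemma meromorphic_function_cases:
  assumes "meromorphic_function f"
  obtains "is_pole (finite_part f) z" "f z = None"
  | "\<not> is_pole (finite_part f) z" "f z = Some (finite_part f z)"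
    "finite_part f \<midarrow>z\<rightarrow> finite_part f z"
proof (cases "f z")
  case None
  with assms that(1) show ?thesis
    by (simp add: meromorphic_function_def)
next
  case (Some w)
  with assms have "\<not> is_pole (finite_part f) z"
    by (metis meromorphic_function_def option.distinct(1))
  moreover from this assms have "finite_part f \<midarrow>z\<rightarrow> finite_part f z"
    by (auto simp: meromorphic_function_def nicely_meromorphic_on_def)
  ultimately show ?thesis
    using Some that(2) by (simp add: finite_part_def)
qed

text \<open>The identity theorem yields equality only near \<open>z\<close>. At \<open>z\<close>
  itself, either both sides are infinite or both finite values are limits of the same germ.\<close>

lemma reflexion_invariance:
  assumes f: "meromorphic_function f" and m: "reflexion m"
    and real: "\<And>z. z \<in> fixed_points m \<Longrightarrow> f z \<in> sphere_real"
  shows "sphere_cnj (f (m z)) = f z"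
proof -
  define F where "F = finite_part f"
  have rev: "sense_reversing m"
    using m by (simp add: reflexion_def)
  obtain p u where u: "u \<noteq> 0" and fix_eq: "fixed_points m = range (\<lambda>t::real. p + of_real t * u)"
    using m by (auto simp: reflexion_def)
  have fixed: "p + of_real t * u \<in> fixed_points m" for t :: real
    using fix_eq by blast
  have "m p = p"
    using fixed[of 0] by (simp add: fixed_points_def)
  hence inv: "m (m w) = w" for w
    using sense_reversing_fixed_point_involution[OF rev] by blast
  \<comment> \<open>Poles on the mirror cause no trouble: \<open>finite_part\<close> is 0 there,
    which is real.\<close>
  have line: "F w = cnj (F (m w))" if "w \<in> fixed_points m" for w
  proof -
    have "cnj (F w) = F w"
      using real[OF that]
      by (auto simp: F_def finite_part_def sphere_real_def Reals_cnj_iff split: option.split)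
    with that show ?thesis
      by (simp add: fixed_points_def)
  qed
  have F_mero: "F meromorphic_on UNIV"
    using f by (simp add: F_def meromorphic_function_def nicely_meromorphic_on_def)
  have "\<exists>\<^sub>F w in at p. F w = cnj (F (m w))"
    by (rule frequently_at_line[OF u]) (rule line[OF fixed])
  hence eq: "\<forall>\<^sub>F w in at z. F w = cnj (F (m w))"
    by (intro meromorphic_identity[OF F_mero meromorphic_on_cnj_sense_reversing[OF F_mero rev], of p])
      auto
  have at_m: "filtermap m (at z) = at (m z)"
    using sense_reversing_tendsto[OF rev] inv by (rule filtermap_at_involution)
  \<comment> \<open>Poles depend only on the punctured germ, and conjugating values preserves the
    norm.\<close>
  have pole_iff: "is_pole F z \<longleftrightarrow> is_pole F (m z)"
    using is_pole_cong[OF eq refl] is_pole_compose_iff[OF at_m, of F]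
    by (simp add: is_pole_cnj_iff o_def)
  show ?thesis
  proof (rule meromorphic_function_cases[OF f, of z])
    assume "is_pole (finite_part f) z" "f z = None"
    moreover from this have "f (m z) = None"
      using pole_iff f by (simp add: F_def meromorphic_function_def)
    ultimately show ?thesis
      by (simp add: sphere_cnj_def)
  next
    assume z: "\<not> is_pole (finite_part f) z" "f z = Some (finite_part f z)"
      "finite_part f \<midarrow>z\<rightarrow> finite_part f z"
    hence "\<not> is_pole (finite_part f) (m z)"
      using pole_iff by (simp add: F_def)
    hence mz: "f (m z) = Some (F (m z))" "F \<midarrow>m z\<rightarrow> F (m z)"
      using meromorphic_function_cases[OF f, of "m z"] by (auto simp: F_def)
    have "(\<lambda>w. F (m w)) \<midarrow>z\<rightarrow> F (m z)"
      using mz(2) by (simp add: at_m[symmetric] filterlim_filtermap)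
    hence "(\<lambda>w. cnj (F (m w))) \<midarrow>z\<rightarrow> cnj (F (m z))"
      by (rule tendsto_cnj)
    moreover have "(\<lambda>w. cnj (F (m w))) \<midarrow>z\<rightarrow> F z"
      using z(3) tendsto_cong[OF eq] by (simp add: F_def)
    ultimately have "cnj (F (m z)) = F z"
      by (rule LIM_unique)
    with z(2) mz(1) show ?thesis
      by (simp add: sphere_cnj_def F_def)
  qed
qed

theorem proposition14:
  fixes W :: "(complex \<Rightarrow> complex) set" and f :: "complex \<Rightarrow> riemann_sphere"
  assumes "wallpaper_group W"
    and "\<exists>m\<in>W. reflexion m"
    and "meromorphic_function f"
  shows "elliptic_function f \<and> invariant_modified W f \<longleftrightarrow>
    (\<forall>g\<in>sensible_subgroup W. \<forall>z. f (g z) = f z) \<and>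
    (\<forall>m\<in>W. reflexion m \<longrightarrow> (\<forall>z\<in>fixed_points m. f z \<in> sphere_real))"
proof
  assume "elliptic_function f \<and> invariant_modified W f"
  hence inv: "modified_action g f = f" if "g \<in> W" for g
    using that by (simp add: invariant_modified_def)
  show "(\<forall>g\<in>sensible_subgroup W. \<forall>z. f (g z) = f z) \<and>
    (\<forall>m\<in>W. reflexion m \<longrightarrow> (\<forall>z\<in>fixed_points m. f z \<in> sphere_real))"
  proof (intro conjI ballI allI impI)
    fix g z assume "g \<in> sensible_subgroup W"
    with fun_cong[OF inv[of g], of z] show "f (g z) = f z"
      by (simp add: sensible_subgroup_def modified_action_def)
  next
    fix m z assume "m \<in> W" "reflexion m" "z \<in> fixed_points m"
    with fun_cong[OF inv[of m], of z] not_sense_preserving_and_reversing[of m]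
    have "sphere_cnj (f z) = f z"
      by (simp add: modified_action_def fixed_points_def reflexion_def)
    thus "f z \<in> sphere_real"
      by (simp add: sphere_cnj_fixed_iff)
  qed
next
  assume "(\<forall>g\<in>sensible_subgroup W. \<forall>z. f (g z) = f z) \<and>
    (\<forall>m\<in>W. reflexion m \<longrightarrow> (\<forall>z\<in>fixed_points m. f z \<in> sphere_real))"
  hence pres: "\<And>g z. g \<in> W \<Longrightarrow> sense_preserving g \<Longrightarrow> f (g z) = f z"
    and real: "\<And>m z. m \<in> W \<Longrightarrow> reflexion m \<Longrightarrow> z \<in> fixed_points m \<Longrightarrow> f z \<in> sphere_real"
    by (auto simp: sensible_subgroup_def)
  obtain s t where "s \<noteq> 0" "t \<noteq> 0" "s / t \<notin> \<real>" "(\<lambda>z. z + s) \<in> W" "(\<lambda>z. z + t) \<in> W"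
    using assms(1) unfolding wallpaper_group_def by blast
  \<comment> \<open>The two independent translations in \<open>W\<close> preserve sense, so their
    vectors serve as periods.\<close>
  hence "elliptic_function f"
    using assms(3) pres[OF _ sense_preserving_translation] unfolding elliptic_function_def
    by blast
  moreover have "invariant_modified W f"
    unfolding invariant_modified_def
  proof
    fix g assume g: "g \<in> W"
    show "modified_action g f = f"
    proof (cases "sense_preserving g")
      case True
      with pres[OF g] show ?thesis
        by (simp add: modified_action_def fun_eq_iff)
    next
      case False
      with g assms(1) have rev: "sense_reversing g"
        by (auto simp: wallpaper_group_def rigid_motion_def)
      obtain m where m: "m \<in> W" "reflexion m"
        using assms(2) by blast
      have m_rev: "sense_reversing m"
        using m by (simp add: reflexion_def)
      have "sphere_cnj (f (g z)) = f z" for z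
      proof -
        \<comment> \<open>Here \<open>g\<close> may be a glide reflexion without any mirror. Because
          \<open>m\<close> is an involution, the left side is \<open>f (g z)\<close>, which reduces
          the claim for \<open>g\<close> to the one for \<open>m\<close>.\<close>
        have "f ((g \<circ> m) (m z)) = f (m z)"
          by (rule pres[OF wallpaper_group_comp[OF assms(1) g m(1)] sense_reversing_comp[OF rev m_rev]])
        moreover have "m (m z) = z"
        proof -
          obtain p where "m p = p"
            using m(2) unfolding reflexion_def fixed_points_def by blast
          with m_rev show ?thesis
            by (rule sense_reversing_fixed_point_involution)
        qed
        ultimately show ?thesis
          using reflexion_invariance[OF assms(3) m(2) real[OF m]] by simp
      qed
      with False show ?thesis
        by (simp add: modified_action_def fun_eq_iff)
    qed
  qed
  ultimately show "elliptic_function f \<and> invariant_modified W f" ..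
qed

end
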